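(* Let $f:\mathbb{R}\to\mathbb{R}$ be a bijection satisfying $f(x+y)=f(x)+f(y)$ for all $x,y\in\mathbb{R}$, and let $g:\mathbb{R}\to(0,\infty)$ be defined by $g(x)=\exp(f(x))$. Then $g$ is a bijection onto $(0,\infty)$ having the Costas property from $\mathbb{R}$ to $(0,\infty)$ with respect to $(0,\infty)$, i.e. for all $x,y\in\mathbb{R}$ and all $z>0$, $g(x+z)-g(x)=g(y+z)-g(y)$ implies $x=y$. Moreover, if the graph of $f$ is dense in $\mathbb{R}^2$, then the graph of $g$ is dense in $\mathbb{R}\times(0,\infty)$. *)

theory Defs
  imports "HOL-Analysis.Analysis"
begin

text \<open>
  The Costas property of \<open>h\<close> from \<open>A\<close> to \<open>B\<close> with respect to a set \<open>C\<close> of shifts. Shifts leaving the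
  domain \<open>A\<close> are disregarded, since \<open>h\<close> is only meaningful on \<open>A\<close>.
\<close>
definition costas_property :: "('a::plus \<Rightarrow> 'b::minus) \<Rightarrow> 'a set \<Rightarrow> 'b set \<Rightarrow> 'a set \<Rightarrow> bool" where
  "costas_property h A B C \<longleftrightarrow>
     h \<in> A \<rightarrow> B \<and>
     (\<forall>x\<in>A. \<forall>y\<in>A. \<forall>z\<in>C. x + z \<in> A \<longrightarrow> y + z \<in> A \<longrightarrow>
        h (x + z) - h x = h (y + z) - h y \<longrightarrow> x = y)"

definition fun_graph :: "('a \<Rightarrow> 'b) \<Rightarrow> ('a \<times> 'b) set" where
  "fun_graph h = {(x, h x) | x. True}"

definition dense_in :: "'a::topological_space set \<Rightarrow> 'a set \<Rightarrow> bool" where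
  "dense_in D S \<longleftrightarrow> D \<subseteq> S \<and> top_of_set S closure_of D = S"

end

theory Submission
  imports Defs
begin

text \<open>
  Since \<open>g (x + z) - g x = g x * (g z - 1)\<close> and \<open>g z \<noteq> 1\<close> for \<open>z \<noteq> 0\<close>, equal differences force
  \<open>g x = g y\<close>. The graph of \<open>g\<close> is the image of the graph of \<open>f\<close> under the continuous surjection
  \<open>(x, y) \<mapsto> (x, exp y)\<close> of the plane onto \<open>UNIV \<times> {0<..}\<close>, and continuous surjections
  preserve density.
\<close>

text \<open>Continuity maps the closure of \<open>D\<close> in \<open>S\<close>, which is all of
  \<open>S\<close>, into the closure of the image of \<open>D\<close>. Closures are relative to
  \<open>S\<close> and to its image, so the target may be a proper subset of its space.\<close>

lemma dense_in_image:
  assumes "continuous_on S h" "dense_in D S"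
  shows "dense_in (h ` D) (h ` S)"
proof -
  have D: "D \<subseteq> S" "top_of_set S closure_of D = S"
    using assms(2) by (auto simp: dense_in_def)
  have "continuous_map (top_of_set S) (top_of_set (h ` S)) h"
    using assms(1) by simp
  from continuous_map_image_closure_subset[OF this, of D]
  have "h ` S \<subseteq> top_of_set (h ` S) closure_of (h ` D)"
    using D(2) by simp
  moreover have "top_of_set (h ` S) closure_of (h ` D) \<subseteq> h ` S"
    using closure_of_subset_topspace[of "top_of_set (h ` S)" "h ` D"] by simp
  ultimately show ?thesis
    using D(1) by (auto simp: dense_in_def)
qed

lemma bij_betw_exp_real: "bij_betw exp (UNIV :: real set) {0<..}"
  by (rule bij_betwI[where g = ln]) auto

lemma costas_property_exp_additive:
  fixes f :: "real \<Rightarrow> real"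
  assumes "inj f" and add: "\<And>x y. f (x + y) = f x + f y"
  shows "costas_property (\<lambda>x. exp (f x)) UNIV {0<..} {0<..}"
proof -
  have "x = y" if "z > 0" and eq: "exp (f (x + z)) - exp (f x) = exp (f (y + z)) - exp (f y)" for x y z
  proof -
    \<comment> \<open>Injectivity enters twice: here it separates \<open>f z\<close> from
      \<open>f 0\<close>, so that \<open>exp (f z) - 1\<close> can be cancelled; at the end it turns
      \<open>f x = f y\<close> into \<open>x = y\<close>.\<close>
    have "f 0 = 0"
      using add[of 0 0] by simp
    then have "f z \<noteq> 0"
      using injD[OF \<open>inj f\<close>, of z 0] \<open>z > 0\<close> by auto
    moreover have "(exp (f x) - exp (f y)) * (exp (f z) - 1) = 0"
      using eq unfolding add exp_add by algebra
    ultimately have "f x = f y"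
      by simp
    then show ?thesis
      using \<open>inj f\<close> by (simp add: inj_eq)
  qed
  moreover have "(\<lambda>x. exp (f x)) \<in> UNIV \<rightarrow> {0<..}"
    by simp
  ultimately show ?thesis
    unfolding costas_property_def greaterThan_iff by blast
qed

lemma dense_in_fun_graph_exp:
  fixes f :: "real \<Rightarrow> real"
  assumes "dense_in (fun_graph f) UNIV"
  shows "dense_in (fun_graph (\<lambda>x. exp (f x))) (UNIV \<times> {0<..})"
proof -
  define h :: "real \<times> real \<Rightarrow> real \<times> real" where "h = map_prod id exp"
  have "continuous_on UNIV h"
    by (auto simp: h_def map_prod_def case_prod_unfold intro!: continuous_intros)
  then have "dense_in (h ` fun_graph f) (h ` UNIV)"
    using assms by (rule dense_in_image)
  moreover have "h ` fun_graph f = fun_graph (\<lambda>x. exp (f x))"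
    by (auto simp: h_def fun_graph_def image_def)
  \<comment> \<open>The image of a product map is the product of the images, here the open upper
    half-plane.\<close>
  moreover have "h ` UNIV = UNIV \<times> {0<..}"
    using map_prod_surj_on[OF surj_id bij_betw_imp_surj_on[OF bij_betw_exp_real]]
    by (simp add: h_def)
  ultimately show ?thesis
    by simp
qed

theorem theorem12:
  fixes f g :: "real \<Rightarrow> real"
  assumes "bij f"
    and "\<And>x y. f (x + y) = f x + f y"
    and "\<And>x. g x = exp (f x)"
  shows "bij_betw g UNIV {0<..} \<and>
         costas_property g UNIV {0<..} {0<..} \<and>
         (dense_in (fun_graph f) (UNIV :: (real \<times> real) set) \<longrightarrow>
          dense_in (fun_graph g) ((UNIV :: real set) \<times> {0<..}))"
proof -
  have g: "g = (\<lambda>x. exp (f x))"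
    using assms(3) by auto
  have "bij_betw g UNIV {0<..}"
    using bij_betw_trans[OF assms(1) bij_betw_exp_real] by (simp add: g comp_def)
  moreover have "costas_property g UNIV {0<..} {0<..}"
    unfolding g using bij_is_inj[OF assms(1)] assms(2) by (rule costas_property_exp_additive)
  ultimately show ?thesis
    using dense_in_fun_graph_exp[of f] by (simp add: g)
qed

end
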